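(* Let $\mathcal X\subset\mathbb R^n$ be closed and convex, $A\in\mathbb R^{m\times n}$, $b\in\mathbb R^m$, $\beta\ge0$, and let $f\in\mathcal S^0_\mu(\mathcal X)$ with $\mu\ge0$. Let $(x^*,\lambda^* )$ be a KKT point of $\min_{x\in\mathcal X}f(x)$ s.t. $Ax=b$. Let $\theta_0=1$, $\gamma_0>0$, $(x_0,v_0)\in\mathcal X\times\mathbb R^n$, $\lambda_0\in\mathbb R^m$, let $\{\alpha_k\}_{k\in\mathbb N}$ be any sequence of positive numbers, and suppose that for all $k\in\mathbb N$ $$\frac{\theta_{k+1}-\theta_k}{\alpha_k}=-\theta_{k+1},\qquad\frac{\gamma_{k+1}-\gamma_k}{\alpha_k}=\mu_\beta-\gamma_{k+1},$$ and that $(\lambda_k,x_k,v_k)$ satisfies the fully implicit scheme $$\theta_k\frac{\lambda_{k+1}-\lambda_k}{\alpha_k}=Av_{k+1}-b,\qquad\frac{x_{k+1}-x_k}{\alpha_k}=v_{k+1}-x_{k+1},$$ $$\gamma_k\frac{v_{k+1}-v_k}{\alpha_k}\in\mu_\beta(x_{k+1}-v_{k+1})-\big(\partial f_\beta(x_{k+1})+N_{\mathcal X}(x_{k+1})+A^\top\lambda_{k+1}\big).$$ Define $$\mathcal E_k=\mathcal L_\beta(x_k,\lambda^* )-\mathcal L_\beta(x^*,\lambda_k)+\frac{\gamma_k}2\|v_k-x^*\|^2+\frac{\theta_k}2\|\lambda_k-\lambda^*\|^2 .$$ Then $\{x_k\}\subset\mathcal X$ and $$\mathcal E_{k+1}-\mathcal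 E_k\le-\alpha_k\mathcal E_{k+1}\quad\text{for all }k\in\mathbb N.$$ Moreover, for all $k\in\mathbb N$, $$\|Ax_k-b\|\le\theta_k\mathcal R_0,\qquad 0\le\mathcal L(x_k,\lambda^* )-\mathcal L(x^*,\lambda_k)\le\theta_k\mathcal E_0,\qquad |f(x_k)-f(x^* )|\le\theta_k\big(\mathcal E_0+\mathcal R_0\|\lambda^*\|\big),$$ where $\theta_k=\prod_{i=0}^{k-1}\frac1{1+\alpha_i}$ and $\mathcal R_0=\sqrt{2\mathcal E_0}+\|\lambda_0-\lambda^*\|+\|Ax_0-b\|$.
   Context: $\|\cdot\|$ is the Euclidean norm. $\mathcal S^0_\mu(\mathcal X)$ ($\mu\ge0$) is the class of proper, closed, convex functions $g:\mathbb R^n\to\mathbb R\cup\{+\infty\}$ with $g(y)\ge g(x)+\langle p,y-x\rangle+\frac\mu2\|y-x\|^2$ for all $x,y\in\mathcal X$ and $p\in\partial g(x)$ ($\partial g$ is the convex subdifferential). Standing assumptions: the domain of $f$ meets $\mathcal X$, $b\in A\mathcal X$, and a KKT point exists. Notation: $f_\beta(x)=f(x)+\frac\beta2\|Ax-b\|^2$; $\mathcal L_\beta(x,\lambda)=f_\beta(x)+\delta_{\mathcal X}(x)+\langle\lambda,Ax-b\rangle$ with $\delta_{\mathcal X}$ the indicator function ($0$ on $\mathcal X$, $+\infty$ elsewhere); $\mathcal L=\mathcal L_0$. $N_{\mathcal X}(x)=\{y:\langle y,z-x\rangle\le0\ \forall z\in\mathcal X\}$ for $x\in\mathcal X$, and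 $N_{\mathcal X}(x)=\emptyset$ for $x\notin\mathcal X$. $\mu_\beta=\mu+\beta\sigma_{\min}^2(A)$, where $\sigma_{\min}^2(A)$ is the smallest eigenvalue of $A^\top A$ (so $\sigma_{\min}(A)>0$ means full column rank). A KKT point $(x^*,\lambda^* )$ satisfies $x^*\in\mathcal X$, $Ax^*=b$ and $0\in\partial f(x^* )+N_{\mathcal X}(x^* )+A^\top\lambda^*$; it is a saddle point: $\mathcal L(x^*,\lambda)\le\mathcal L(x^*,\lambda^* )\le\mathcal L(x,\lambda^* )$ for all $x,\lambda$. Convention: since $f$ may take the value $+\infty$, inequalities are read in $(-\infty,+\infty]$, and the inequality $\mathcal E_{k+1}-\mathcal E_k\le-\alpha_k\mathcal E_{k+1}$ is understood as $(1+\alpha_k)\mathcal E_{k+1}\le\mathcal E_k$. *)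

theory Defs
  imports "HOL-Analysis.Analysis"
begin

definition ereal_epigraph :: "('a \<Rightarrow> ereal) \<Rightarrow> ('a \<times> real) set" where
  "ereal_epigraph g = {(x, r). g x \<le> ereal r}"

definition proper_function :: "('a \<Rightarrow> ereal) \<Rightarrow> bool" where
  "proper_function g \<longleftrightarrow> (\<forall>x. g x \<noteq> -\<infinity>) \<and> (\<exists>x. g x \<noteq> \<infinity>)"

definition effective_domain :: "('a \<Rightarrow> ereal) \<Rightarrow> 'a set" where
  "effective_domain g = {x. g x < \<infinity>}"

(* For proper g this set is empty at points where g x = \<infinity>. *)
definition subdifferential :: "('a::real_inner \<Rightarrow> ereal) \<Rightarrow> 'a \<Rightarrow> 'a set" where
  "subdifferential g x = {p. \<forall>y. g y \<ge> g x + ereal (p \<bullet> (y - x))}"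

definition normal_cone :: "'a::real_inner set \<Rightarrow> 'a \<Rightarrow> 'a set" where
  "normal_cone X x = (if x \<in> X then {y. \<forall>z\<in>X. y \<bullet> (z - x) \<le> 0} else {})"

(* The class S^0_mu(X).  Values lie in (-\<infinity>, +\<infinity>] by properness; closedness and convexity
   of a function are those of its epigraph. *)
definition S0_class :: "real \<Rightarrow> 'a::euclidean_space set \<Rightarrow> ('a \<Rightarrow> ereal) set" where
  "S0_class \<mu> X = {g. proper_function g \<and> closed (ereal_epigraph g) \<and> convex (ereal_epigraph g) \<and>
     (\<forall>x\<in>X. \<forall>y\<in>X. \<forall>p\<in>subdifferential g x.
        g y \<ge> g x + ereal (p \<bullet> (y - x)) + ereal (\<mu> / 2 * (norm (y - x))\<^sup>2))}"

definition matrix_eigenvalue :: "real ^ 'n ^ 'n \<Rightarrow> real \<Rightarrow> bool" where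
  "matrix_eigenvalue M c \<longleftrightarrow> (\<exists>w. w \<noteq> 0 \<and> M *v w = c *\<^sub>R w)"

definition sigma_min_sq :: "real ^ 'n ^ 'm \<Rightarrow> real" where
  "sigma_min_sq A = (LEAST c. matrix_eigenvalue (transpose A ** A) c)"

definition mu_beta :: "real \<Rightarrow> real \<Rightarrow> real ^ 'n ^ 'm \<Rightarrow> real" where
  "mu_beta \<mu> \<beta> A = \<mu> + \<beta> * sigma_min_sq A"

definition f_beta ::
  "(real ^ 'n \<Rightarrow> ereal) \<Rightarrow> real ^ 'n ^ 'm \<Rightarrow> real ^ 'm \<Rightarrow> real \<Rightarrow> real ^ 'n \<Rightarrow> ereal" where
  "f_beta f A b \<beta> x = f x + ereal (\<beta> / 2 * (norm (A *v x - b))\<^sup>2)"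

definition indicator_fun :: "'a set \<Rightarrow> 'a \<Rightarrow> ereal" where
  "indicator_fun X x = (if x \<in> X then 0 else \<infinity>)"

definition aug_lagrangian ::
  "(real ^ 'n \<Rightarrow> ereal) \<Rightarrow> (real ^ 'n) set \<Rightarrow> real ^ 'n ^ 'm \<Rightarrow> real ^ 'm \<Rightarrow> real
    \<Rightarrow> real ^ 'n \<Rightarrow> real ^ 'm \<Rightarrow> ereal" where
  "aug_lagrangian f X A b \<beta> x l =
     f_beta f A b \<beta> x + indicator_fun X x + ereal (l \<bullet> (A *v x - b))"

abbreviation lagrangian ::
  "(real ^ 'n \<Rightarrow> ereal) \<Rightarrow> (real ^ 'n) set \<Rightarrow> real ^ 'n ^ 'm \<Rightarrow> real ^ 'm
    \<Rightarrow> real ^ 'n \<Rightarrow> real ^ 'm \<Rightarrow> ereal" where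
  "lagrangian f X A b \<equiv> aug_lagrangian f X A b 0"

(* The Minkowski sum of the subdifferential of g at x, the normal cone of X at x, and the
   vector A^T l. *)
definition kkt_operator ::
  "(real ^ 'n \<Rightarrow> ereal) \<Rightarrow> (real ^ 'n) set \<Rightarrow> real ^ 'n ^ 'm \<Rightarrow> real ^ 'n \<Rightarrow> real ^ 'm
    \<Rightarrow> (real ^ 'n) set" where
  "kkt_operator g X A x l =
     {p + q + transpose A *v l | p q. p \<in> subdifferential g x \<and> q \<in> normal_cone X x}"

definition kkt_point ::
  "(real ^ 'n \<Rightarrow> ereal) \<Rightarrow> (real ^ 'n) set \<Rightarrow> real ^ 'n ^ 'm \<Rightarrow> real ^ 'm
    \<Rightarrow> real ^ 'n \<Rightarrow> real ^ 'm \<Rightarrow> bool" where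
  "kkt_point f X A b x l \<longleftrightarrow> x \<in> X \<and> A *v x = b \<and> 0 \<in> kkt_operator f X A x l"

(* Only used at nonnegative arguments; the library has no square root on ereal. *)
definition ereal_sqrt :: "ereal \<Rightarrow> ereal" where
  "ereal_sqrt e = (if e = \<infinity> then \<infinity> else ereal (sqrt (real_of_ereal e)))"

end

theory Submission
  imports Defs
begin

text \<open>
  The scheme discretises a flow for which the energy \<open>E\<close> is a Lyapunov function, and being
  fully implicit it inherits the decay without a step size restriction. In one step the two squared
  distances change by at most twice the inner product of the increment with the new error
  (\<open>norm\<^sup>2\<close> is convex). When the scheme is inserted, the inclusion for \<open>v\<close> is paired with
  \<open>v' - xs = (x' - xs) + (x' - x) / \<alpha>\<close>. Its subgradient therefore gets tested against both \<open>x\<close>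
  and \<open>xs\<close>: the test against \<open>x\<close> pays for the change of the objective, and the test against
  \<open>xs\<close> yields the contraction term \<open>- \<alpha> E'\<close>. The pairings with the new multiplier cancel exactly,
  and the remaining quadratic terms in \<open>m = mu_beta \<mu> \<beta> A\<close> are absorbed by the recursion of
  \<open>\<gamma>\<close>. This is \<open>implicit_step_energy_decay\<close>.

  Testing against \<open>xs\<close> requires strong convexity of the augmented objective on \<open>X\<close> with modulus
  \<open>m\<close> (\<open>f_beta_strongly_convex\<close>). It combines a sum rule, by which a subgradient of
  \<open>f_beta\<close> minus the gradient of the penalty is a subgradient of \<open>f\<close>, with the bound of
  \<open>norm (A *v d)\<close> from below by the smallest eigenvalue of the Gram matrix.

  The decay gives \<open>E k \<le> \<theta> k * E 0\<close>, and all parts of the energy are nonnegative by the saddle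
  point inequality \<open>kkt_point_lower_bound\<close>. The gap estimate is then immediate. The energy
  also bounds \<open>l k\<close> uniformly, because the factor \<open>\<theta> k\<close> in front of the multiplier error cancels
  against the decay. For feasibility, \<open>l k - (A *v x k - b) / \<theta> k\<close> is conserved along the iteration
  (\<open>multiplier_residual_invariant\<close>), so the boundedness of the multipliers says that the
  residual is of order \<open>\<theta> k\<close>. The estimate of the objective follows from the gap and the residual
  by the Cauchy-Schwarz inequality.

  The starting point may satisfy \<open>f (x 0) = \<infinity>\<close>, in which case \<open>E 0\<close> and \<open>R0\<close> are infinite and
  the bounds hold trivially. From index 1 on, the existence of a subgradient forces \<open>f\<close> to be finite.
\<close>

section \<open>The smallest eigenvalue of the Gram matrix\<close>

lemma Gram_inner_eq:
  fixes A :: "real ^ 'n ^ 'm"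
  shows "((transpose A ** A) *v w) \<bullet> u = (A *v w) \<bullet> (A *v u)"
  by (simp add: dot_lmul_matrix matrix_vector_mul_assoc[symmetric])

text \<open>
  The nonnegative quadratic form \<open>norm (A *v u)\<^sup>2 - c * norm u\<^sup>2\<close> vanishes at \<open>w\<close>, so \<open>w\<close> is a
  minimiser and the gradient there must be zero. Half of this gradient is the defect \<open>g\<close> of the
  eigenvector equation. The proof moves from \<open>w\<close> in the direction of \<open>- g\<close>, where a nonzero \<open>g\<close>
  would make the form negative.
\<close>

lemma Rayleigh_min_eigenvector:
  fixes A :: "real ^ 'n ^ 'm"
  assumes min: "\<And>u. c * (norm u)\<^sup>2 \<le> (norm (A *v u))\<^sup>2"
    and att: "(norm (A *v w))\<^sup>2 = c * (norm w)\<^sup>2"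
  shows "(transpose A ** A) *v w = c *\<^sub>R w"
proof -
  define g where "g = (transpose A ** A) *v w - c *\<^sub>R w"
  have gu: "g \<bullet> u = (A *v w) \<bullet> (A *v u) - c * (w \<bullet> u)" for u
    by (simp add: g_def inner_diff_left Gram_inner_eq)
  define K where "K = (norm (A *v g))\<^sup>2 - c * (norm g)\<^sup>2"
  have K0: "K \<ge> 0" using min[of g] by (simp add: K_def)
  have quad: "0 \<le> 2 * t * (norm g)\<^sup>2 + t\<^sup>2 * K" for t :: real
  proof -
    have "(norm (A *v (w + t *\<^sub>R g)))\<^sup>2 - c * (norm (w + t *\<^sub>R g))\<^sup>2
        = ((norm (A *v w))\<^sup>2 - c * (norm w)\<^sup>2) + 2 * t * ((A *v w) \<bullet> (A *v g) - c * (w \<bullet> g)) + t\<^sup>2 * K"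
      unfolding K_def power2_norm_eq_inner
      by (simp add: matrix_vector_right_distrib matrix_vector_mult_scaleR inner_add_left inner_add_right
          algebra_simps power2_eq_square inner_commute)
    then show ?thesis using min[of "w + t *\<^sub>R g"] att gu[of g] by (simp add: power2_norm_eq_inner)
  qed
  have "(norm g)\<^sup>2 \<le> 0"
  proof (rule ccontr)
    assume "\<not> (norm g)\<^sup>2 \<le> 0"
    then have G: "(norm g)\<^sup>2 > 0" by simp
    \<comment> \<open>A step short enough for the linear term to dominate;
        \<open>K + 1\<close> keeps the denominator positive when \<open>K = 0\<close>.\<close>
    define t where "t = - (norm g)\<^sup>2 / (K + 1)"
    have tK: "t * (K + 1) = - (norm g)\<^sup>2" using K0 by (simp add: t_def)
    have "2 * t * (norm g)\<^sup>2 + t\<^sup>2 * K = t * (2 * (norm g)\<^sup>2 + t * (K + 1) - t)"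
      by (simp add: algebra_simps power2_eq_square)
    also have "\<dots> = t * ((norm g)\<^sup>2 - t)" by (simp add: tK)
    also have "\<dots> < 0"
    proof -
      have "t < 0" using G K0 by (simp add: t_def)
      then show ?thesis using G by (intro mult_neg_pos) linarith+
    qed
    finally show False using quad[of t] by simp
  qed
  then have "g = 0" by simp
  then show ?thesis by (simp add: g_def)
qed

text \<open>
  The minimum \<open>c\<close> of \<open>norm (A *v u)\<^sup>2\<close> over the unit sphere is attained by compactness, hence is an
  eigenvalue of the Gram matrix, and the Rayleigh quotient of any eigenvector shows that no eigenvalue
  is smaller. Thus the set over which \<open>sigma_min_sq\<close> takes the least element has one, namely \<open>c\<close>.
\<close>

lemma sigma_min_sq_Rayleigh:
  fixes A :: "real ^ 'n ^ 'm"
  shows "0 \<le> sigma_min_sq A"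
    and "sigma_min_sq A * (norm u)\<^sup>2 \<le> (norm (A *v u))\<^sup>2"
proof -
  let ?S = "sphere (0 :: real ^ 'n) 1"
  have "continuous_on ?S (\<lambda>u. (norm (A *v u))\<^sup>2)"
    by (intro continuous_intros linear_continuous_on_compose[where g = "(*v) A"]) auto
  moreover have "axis undefined 1 \<in> ?S" by (simp add: norm_axis_1)
  ultimately obtain w where w: "w \<in> ?S" and wmin: "\<And>u. u \<in> ?S \<Longrightarrow> (norm (A *v w))\<^sup>2 \<le> (norm (A *v u))\<^sup>2"
    using continuous_attains_inf[of ?S] by (metis compact_sphere empty_iff)
  define c where "c = (norm (A *v w))\<^sup>2"
  have min: "c * (norm u)\<^sup>2 \<le> (norm (A *v u))\<^sup>2" for u
  proof (cases "u = 0")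
    case False
    then have "(1 / norm u) *\<^sub>R u \<in> ?S" by simp
    from wmin[OF this] have "c \<le> (norm (A *v u))\<^sup>2 / (norm u)\<^sup>2"
      by (simp add: c_def matrix_vector_mult_scaleR power_divide)
    then show ?thesis using False by (simp add: field_simps)
  qed simp
  have nw: "norm w = 1" using w by simp
  then have w0: "w \<noteq> 0" by auto
  have "sigma_min_sq A = c"
    unfolding sigma_min_sq_def
  proof (rule Least_equality)
    show "matrix_eigenvalue (transpose A ** A) c"
      unfolding matrix_eigenvalue_def
      using Rayleigh_min_eigenvector[OF min, of w] nw w0 by (auto simp: c_def)
  next
    fix d assume "matrix_eigenvalue (transpose A ** A) d"
    then obtain z where z: "z \<noteq> 0" "(transpose A ** A) *v z = d *\<^sub>R z"
      by (auto simp: matrix_eigenvalue_def)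
    have "(norm (A *v z))\<^sup>2 = d * (norm z)\<^sup>2"
      using Gram_inner_eq[of A z z] z by (simp add: power2_norm_eq_inner)
    then show "c \<le> d" using min[of z] z by simp
  qed
  then show "0 \<le> sigma_min_sq A" "sigma_min_sq A * (norm u)\<^sup>2 \<le> (norm (A *v u))\<^sup>2"
    using min by (auto simp: c_def)
qed

section \<open>Subgradients of the augmented objective\<close>

lemma subdifferential_imp_finite:
  assumes "proper_function g" "p \<in> subdifferential g x"
  shows "\<bar>g x\<bar> \<noteq> \<infinity>"
proof -
  obtain y where "g y \<noteq> \<infinity>" using assms by (auto simp: proper_function_def)
  moreover have "g y \<ge> g x + ereal (p \<bullet> (y - x))" using assms by (auto simp: subdifferential_def)
  ultimately have "g x \<noteq> \<infinity>" by auto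
  then show ?thesis using assms by (auto simp: proper_function_def)
qed

lemma norm_sq_affine_expand:
  fixes A :: "real ^ 'n ^ 'm"
  shows "(norm (A *v (x + t *\<^sub>R d) - b))\<^sup>2
    = (norm (A *v x - b))\<^sup>2 + 2 * t * ((A *v x - b) \<bullet> (A *v d)) + t\<^sup>2 * (norm (A *v d))\<^sup>2"
  unfolding power2_norm_eq_inner
  by (simp add: matrix_vector_right_distrib matrix_vector_mult_scaleR
          algebra_simps power2_eq_square inner_commute)

text \<open>
  One half of the sum rule for a convex function and a smooth one, here for a quadratic smooth term. On the segment from \<open>x\<close> to \<open>y\<close> convexity of \<open>f\<close> bounds its increment
  from above by the chord, while the subgradient of the sum bounds it from below up to the exact
  second order remainder of the penalty. After division by the step length the remainder
  vanishes as the step tends to zero.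
\<close>

lemma subdifferential_f_beta_imp:
  fixes f :: "real ^ 'n \<Rightarrow> ereal" and A :: "real ^ 'n ^ 'm"
  assumes proper: "proper_function f" and conv: "convex (ereal_epigraph f)" and "0 \<le> \<beta>"
    and p: "p \<in> subdifferential (f_beta f A b \<beta>) x"
  shows "p - \<beta> *\<^sub>R (transpose A *v (A *v x - b)) \<in> subdifferential f x"
proof -
  let ?r = "\<lambda>y. \<beta> / 2 * (norm (A *v y - b))\<^sup>2"
  have "proper_function (f_beta f A b \<beta>)"
    using proper by (auto simp: proper_function_def f_beta_def)
  from subdifferential_imp_finite[OF this p] obtain fx where fx: "f x = ereal fx"
    by (cases "f x") (auto simp: f_beta_def)
  have "f y \<ge> f x + ereal ((p - \<beta> *\<^sub>R (transpose A *v (A *v x - b))) \<bullet> (y - x))" for y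
  proof (cases "f y")
    case (real fy)
    define d where "d = y - x"
    define e where "e = p \<bullet> d - \<beta> * ((A *v x - b) \<bullet> (A *v d))"
    have chord: "e - t * (\<beta> / 2 * (norm (A *v d))\<^sup>2) \<le> fy - fx" if t: "0 < t" "t \<le> 1" for t
    proof -
      have "(1 - t) *\<^sub>R (x, fx) + t *\<^sub>R (y, fy) \<in> ereal_epigraph f"
        using conv t by (intro convexD) (auto simp: ereal_epigraph_def fx real)
      moreover have "(1 - t) *\<^sub>R x + t *\<^sub>R y = x + t *\<^sub>R d" by (simp add: d_def algebra_simps)
      ultimately have "f (x + t *\<^sub>R d) \<le> ereal ((1 - t) * fx + t * fy)"
        by (simp add: ereal_epigraph_def)
      moreover have "f x + ereal (?r x) + ereal (p \<bullet> (t *\<^sub>R d)) \<le> f (x + t *\<^sub>R d) + ereal (?r (x + t *\<^sub>R d))"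
        using p by (auto simp: subdifferential_def f_beta_def dest: spec[of _ "x + t *\<^sub>R d"])
      ultimately have "fx + ?r x + t * (p \<bullet> d) \<le> (1 - t) * fx + t * fy + ?r (x + t *\<^sub>R d)"
        by (cases "f (x + t *\<^sub>R d)") (auto simp: fx)
      then have "t * (e - t * (\<beta> / 2 * (norm (A *v d))\<^sup>2)) \<le> t * (fy - fx)"
        unfolding norm_sq_affine_expand e_def by (simp add: field_simps power2_eq_square)
      then show ?thesis using t by simp
    qed
    have "((\<lambda>t. e - t * (\<beta> / 2 * (norm (A *v d))\<^sup>2)) \<longlongrightarrow> e - 0 * (\<beta> / 2 * (norm (A *v d))\<^sup>2)) (at_right 0)"
      by (intro tendsto_intros)
    moreover have "\<forall>\<^sub>F t in at_right 0. e - t * (\<beta> / 2 * (norm (A *v d))\<^sup>2) \<le> fy - fx"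
      using chord by (auto simp: eventually_at_right_field intro!: exI[of _ 1])
    ultimately have "e \<le> fy - fx"
      using tendsto_upperbound[of _ _ "at_right (0::real)"] by fastforce
    moreover have "(p - \<beta> *\<^sub>R (transpose A *v (A *v x - b))) \<bullet> (y - x) = e"
      by (simp add: e_def d_def inner_diff_left dot_lmul_matrix)
    ultimately show ?thesis by (simp add: fx real)
  qed (use proper in \<open>auto simp: proper_function_def\<close>)
  then show ?thesis by (simp add: subdifferential_def)
qed

text \<open>
  The modulus \<open>\<mu>\<close> comes from \<open>f\<close>. The penalty is quadratic, so it exceeds its linearisation
  by exactly \<open>\<beta> / 2 * norm (A *v (y - x))\<^sup>2\<close>, which contributes \<open>\<beta> * sigma_min_sq A\<close>.
\<close>

lemma f_beta_strongly_convex: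
  fixes f :: "real ^ 'n \<Rightarrow> ereal" and A :: "real ^ 'n ^ 'm"
  assumes f: "f \<in> S0_class \<mu> X" and "0 \<le> \<beta>" and x: "x \<in> X" and y: "y \<in> X"
    and p: "p \<in> subdifferential (f_beta f A b \<beta>) x"
  shows "f_beta f A b \<beta> x + ereal (p \<bullet> (y - x) + mu_beta \<mu> \<beta> A / 2 * (norm (y - x))\<^sup>2)
    \<le> f_beta f A b \<beta> y"
proof -
  define d where "d = y - x"
  let ?p = "p - \<beta> *\<^sub>R (transpose A *v (A *v x - b))"
  have proper: "proper_function f" and conv: "convex (ereal_epigraph f)"
    using f by (auto simp: S0_class_def)
  have p': "?p \<in> subdifferential f x"
    by (rule subdifferential_f_beta_imp[OF proper conv \<open>0 \<le> \<beta>\<close> p])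
  obtain fx where fx: "f x = ereal fx"
    using subdifferential_imp_finite[OF proper p'] by (cases "f x") auto
  have strong: "f y \<ge> f x + ereal (?p \<bullet> (y - x)) + ereal (\<mu> / 2 * (norm (y - x))\<^sup>2)"
    using f x y p' by (auto simp: S0_class_def)
  have pd: "?p \<bullet> d = p \<bullet> d - \<beta> * ((A *v x - b) \<bullet> (A *v d))"
    by (simp add: inner_diff_left dot_lmul_matrix)
  have Ay: "(norm (A *v y - b))\<^sup>2
      = (norm (A *v x - b))\<^sup>2 + 2 * ((A *v x - b) \<bullet> (A *v d)) + (norm (A *v d))\<^sup>2"
    using norm_sq_affine_expand[of A x 1 d b] by (simp add: d_def)
  have "\<beta> * (sigma_min_sq A * (norm d)\<^sup>2) \<le> \<beta> * (norm (A *v d))\<^sup>2"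
    using \<open>0 \<le> \<beta>\<close> by (intro mult_left_mono sigma_min_sq_Rayleigh)
  then have "\<beta> / 2 * (norm (A *v x - b))\<^sup>2 + (p \<bullet> d + mu_beta \<mu> \<beta> A / 2 * (norm d)\<^sup>2)
      \<le> ?p \<bullet> d + \<mu> / 2 * (norm d)\<^sup>2 + \<beta> / 2 * (norm (A *v y - b))\<^sup>2"
    unfolding pd Ay mu_beta_def by (simp add: algebra_simps)
  then show ?thesis using strong unfolding d_def[symmetric]
    by (cases "f y") (auto simp: f_beta_def fx)
qed

text \<open>
  The minimising half of the saddle point property: the subgradient inequality at \<open>xs\<close>, with the
  subgradient expressed through the normal vector and the multiplier. It makes the Lagrangian gap
  nonnegative, the only part of the energy that is not a nonnegative multiple of a square.
\<close>

lemma kkt_point_lower_bound: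
  fixes f :: "real ^ 'n \<Rightarrow> ereal" and A :: "real ^ 'n ^ 'm"
  assumes "kkt_point f X A b xs ls" and "y \<in> X"
  shows "f xs \<le> f y + ereal (ls \<bullet> (A *v y - b))"
proof -
  obtain p q where p: "p \<in> subdifferential f xs" and q: "q \<in> normal_cone X xs"
    and pq: "p + q + transpose A *v ls = 0" and xs: "xs \<in> X" "A *v xs = b"
    using assms(1) by (auto simp: kkt_point_def kkt_operator_def)
  have "q \<bullet> (y - xs) \<le> 0" using q assms(2) xs by (simp add: normal_cone_def)
  moreover have "(p + q + transpose A *v ls) \<bullet> (y - xs) = 0" by (simp only: pq inner_zero_left)
  moreover have "(transpose A *v ls) \<bullet> (y - xs) = ls \<bullet> (A *v y - b)"
    by (simp add: dot_lmul_matrix matrix_vector_mult_diff_distrib xs)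
  ultimately have "0 \<le> p \<bullet> (y - xs) + ls \<bullet> (A *v y - b)" by (simp add: inner_add_left)
  moreover have "f xs + ereal (p \<bullet> (y - xs)) \<le> f y" using p by (auto simp: subdifferential_def)
  ultimately show ?thesis by (cases "f xs"; cases "f y") auto
qed

section \<open>Decay of the energy in one implicit step\<close>

text \<open>
  The multiplier step uses the residual at the extrapolated point \<open>v'\<close>. This identity turns it into a
  difference of residuals of the primal iterates.
\<close>

lemma extrapolated_residual:
  fixes A :: "real ^ 'n ^ 'm"
  assumes "x' - x = \<alpha> *\<^sub>R (v' - x')"
  shows "\<alpha> *\<^sub>R (A *v v' - b) = (1 + \<alpha>) *\<^sub>R (A *v x' - b) - (A *v x - b)"
proof -
  have "\<alpha> *\<^sub>R (A *v v') = A *v (\<alpha> *\<^sub>R v')" by (simp add: matrix_vector_mult_scaleR)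
  also have "\<alpha> *\<^sub>R v' = (1 + \<alpha>) *\<^sub>R x' - x" using assms by (simp add: algebra_simps)
  finally show ?thesis
    by (simp add: matrix_vector_mult_diff_distrib matrix_vector_mult_scaleR algebra_simps)
qed

text \<open>
  Primed variables are the new iterate. The numbers \<open>\<phi>\<close>, \<open>\<phi>'\<close> and \<open>\<phi>s\<close> stand for the values of the
  augmented objective at \<open>x\<close>, \<open>x'\<close> and \<open>xs\<close>, and \<open>s\<close> for a subgradient at \<open>x'\<close> of that
  objective plus the indicator of the constraint set; only its two inequalities enter, so the argument is
  one about real numbers. The scheme and the recursions are cleared of denominators.
\<close>

lemma implicit_step_energy_decay:
  fixes A :: "real ^ 'n ^ 'm" and \<phi> \<phi>' \<phi>s :: real
  assumes "0 < \<alpha>" "0 \<le> \<gamma>" "0 \<le> \<theta>"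
    and \<theta>': "(1 + \<alpha>) * \<theta>' = \<theta>" and \<gamma>': "(1 + \<alpha>) * \<gamma>' = \<gamma> + \<alpha> * m"
    and l': "\<theta> *\<^sub>R (l' - l) = \<alpha> *\<^sub>R (A *v v' - b)"
    and x': "x' - x = \<alpha> *\<^sub>R (v' - x')"
    and v': "\<gamma> *\<^sub>R (v' - v) = \<alpha> *\<^sub>R (m *\<^sub>R (x' - v') - (s + transpose A *v l'))"
    and s_x: "\<phi>' + s \<bullet> (x - x') \<le> \<phi>"
    and s_xs: "\<phi>' + s \<bullet> (xs - x') + m / 2 * (norm (xs - x'))\<^sup>2 \<le> \<phi>s"
    and m: "0 \<le> m"
    and xs: "A *v xs = b"
  shows "(1 + \<alpha>) * (\<phi>' + ls \<bullet> (A *v x' - b) - \<phi>s + \<gamma>' / 2 * (norm (v' - xs))\<^sup>2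
            + \<theta>' / 2 * (norm (l' - ls))\<^sup>2)
    \<le> \<phi> + ls \<bullet> (A *v x - b) - \<phi>s + \<gamma> / 2 * (norm (v - xs))\<^sup>2 + \<theta> / 2 * (norm (l - ls))\<^sup>2"
proof -
  have convex_sq: "r * (norm (z' - c))\<^sup>2 - r * (norm (z - c))\<^sup>2 \<le> 2 * ((r *\<^sub>R (z' - z)) \<bullet> (z' - c))"
    if "0 \<le> r" for r and z z' c :: "'a::real_inner"
  proof -
    have "2 * ((r *\<^sub>R (z' - z)) \<bullet> (z' - c)) - (r * (norm (z' - c))\<^sup>2 - r * (norm (z - c))\<^sup>2)
        = r * (norm (z' - z))\<^sup>2"
      unfolding power2_norm_eq_inner by (simp add: algebra_simps inner_commute)
    moreover have "0 \<le> r * (norm (z' - z))\<^sup>2" using that by simp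
    ultimately show ?thesis by linarith
  qed
  define D where "D = A *v x' - b"
  define D0 where "D0 = A *v x - b"
  have Av: "\<alpha> *\<^sub>R (A *v v' - b) = (1 + \<alpha>) *\<^sub>R D - D0"
    unfolding D_def D0_def by (rule extrapolated_residual[OF x'])
  have "\<gamma> * (norm (v' - xs))\<^sup>2 - \<gamma> * (norm (v - xs))\<^sup>2 \<le> 2 * ((\<gamma> *\<^sub>R (v' - v)) \<bullet> (v' - xs))"
    using convex_sq \<open>0 \<le> \<gamma>\<close> .
  also have "(\<gamma> *\<^sub>R (v' - v)) \<bullet> (v' - xs)
      = \<alpha> * m * ((x' - v') \<bullet> (v' - xs)) - s \<bullet> (\<alpha> *\<^sub>R (v' - xs)) - l' \<bullet> (\<alpha> *\<^sub>R (A *v v' - b))"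
    unfolding v' by (simp add: inner_diff_left inner_add_left dot_lmul_matrix
        matrix_vector_mult_diff_distrib xs algebra_simps)
  also have "\<alpha> *\<^sub>R (v' - xs) = - (x - x') - \<alpha> *\<^sub>R (xs - x')" using x' by (simp add: algebra_simps)
  finally have vpart: "\<gamma> * (norm (v' - xs))\<^sup>2 - \<gamma> * (norm (v - xs))\<^sup>2
      \<le> 2 * (\<alpha> * m * ((x' - v') \<bullet> (v' - xs)) + s \<bullet> (x - x') + \<alpha> * (s \<bullet> (xs - x'))
             - ((1 + \<alpha>) * (l' \<bullet> D) - l' \<bullet> D0))"
    by (simp add: Av inner_diff_right)
  have lpart: "\<theta> * (norm (l' - ls))\<^sup>2 - \<theta> * (norm (l - ls))\<^sup>2
      \<le> 2 * ((1 + \<alpha>) * (l' \<bullet> D) - l' \<bullet> D0 - (1 + \<alpha>) * (ls \<bullet> D) + ls \<bullet> D0)"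
    using convex_sq[OF \<open>0 \<le> \<theta>\<close>, of l' ls l] unfolding l' Av
    by (simp add: inner_diff_left inner_diff_right inner_commute right_diff_distrib)
  \<comment> \<open>The polarisation identity, without the square of \<open>x' - v'\<close>.
      The first square on the right is paid for by strong convexity at \<open>xs\<close>,
      the second by the recursion of \<open>\<gamma>\<close>.\<close>
  have three: "2 * ((x' - v') \<bullet> (v' - xs)) \<le> (norm (xs - x'))\<^sup>2 - (norm (v' - xs))\<^sup>2"
  proof -
    have "(norm (xs - x'))\<^sup>2 - (norm (v' - xs))\<^sup>2 - 2 * ((x' - v') \<bullet> (v' - xs)) = (norm (x' - v'))\<^sup>2"
      unfolding power2_norm_eq_inner by (simp add: algebra_simps inner_commute)
    then show ?thesis by (smt (verit) zero_le_power2)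
  qed
  have three': "\<alpha> * m * (2 * ((x' - v') \<bullet> (v' - xs))) \<le> \<alpha> * m * ((norm (xs - x'))\<^sup>2 - (norm (v' - xs))\<^sup>2)"
    using three \<open>0 < \<alpha>\<close> m by (intro mult_left_mono) auto
  have sxs': "\<alpha> * (\<phi>' + s \<bullet> (xs - x') + m / 2 * (norm (xs - x'))\<^sup>2) \<le> \<alpha> * \<phi>s"
    using s_xs \<open>0 < \<alpha>\<close> by simp
  have g2: "(1 + \<alpha>) * (\<gamma>' / 2 * (norm (v' - xs))\<^sup>2) = (\<gamma> + \<alpha> * m) / 2 * (norm (v' - xs))\<^sup>2"
    by (simp add: \<gamma>'[symmetric])
  have t2: "(1 + \<alpha>) * (\<theta>' / 2 * (norm (l' - ls))\<^sup>2) = \<theta> / 2 * (norm (l' - ls))\<^sup>2"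
    by (simp add: \<theta>'[symmetric])
  have "(1 + \<alpha>) * (\<phi>' + ls \<bullet> D - \<phi>s + \<gamma>' / 2 * (norm (v' - xs))\<^sup>2 + \<theta>' / 2 * (norm (l' - ls))\<^sup>2)
    = (1 + \<alpha>) * (\<phi>' + ls \<bullet> D - \<phi>s) + (\<gamma> + \<alpha> * m) / 2 * (norm (v' - xs))\<^sup>2 + \<theta> / 2 * (norm (l' - ls))\<^sup>2"
    unfolding g2[symmetric] t2[symmetric] by (simp only: distrib_left)
  also have "\<dots> \<le> \<phi> + ls \<bullet> D0 - \<phi>s + \<gamma> / 2 * (norm (v - xs))\<^sup>2 + \<theta> / 2 * (norm (l - ls))\<^sup>2"
    using vpart lpart three' sxs' s_x
    by (simp add: algebra_simps add_divide_distrib)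
  finally show ?thesis by (simp only: D_def D0_def)
qed

section \<open>Conserved quantity and decay factor\<close>

text \<open>
  Divided by \<open>\<theta> k\<close>, the multiplier step reads
  \<open>l (Suc k) - l k = D (Suc k) / \<theta> (Suc k) - D k / \<theta> k\<close>, which telescopes. No norm is taken, so the
  residual inherits the rate of \<open>\<theta>\<close> without loss.
\<close>

lemma multiplier_residual_invariant:
  fixes l D :: "nat \<Rightarrow> 'a::real_vector" and \<theta> \<alpha> :: "nat \<Rightarrow> real"
  assumes "\<theta> 0 = 1" and pos: "\<And>k. 0 < \<theta> k"
    and \<theta>: "\<And>k. (1 + \<alpha> k) * \<theta> (Suc k) = \<theta> k"
    and step: "\<And>k. \<theta> k *\<^sub>R (l (Suc k) - l k) = (1 + \<alpha> k) *\<^sub>R D (Suc k) - D k"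
  shows "D k = \<theta> k *\<^sub>R (l k - l 0 + D 0)"
proof (induction k)
  case 0
  show ?case using \<open>\<theta> 0 = 1\<close> by simp
next
  case (Suc k)
  have "(1 + \<alpha> k) *\<^sub>R D (Suc k) = \<theta> k *\<^sub>R (l (Suc k) - l k) + D k"
    using step[of k] by simp
  also have "\<dots> = \<theta> k *\<^sub>R (l (Suc k) - l 0 + D 0)"
    by (subst Suc.IH) (simp add: algebra_simps)
  also have "\<dots> = (1 + \<alpha> k) *\<^sub>R (\<theta> (Suc k) *\<^sub>R (l (Suc k) - l 0 + D 0))"
    by (simp only: scaleR_scaleR \<theta>)
  finally show ?case
    using \<theta>[of k] pos[of k] by (metis less_irrefl mult_zero_left scaleR_left_imp_eq)
qed

lemma decay_factor_eq_prod:
  fixes \<theta> \<alpha> :: "nat \<Rightarrow> real"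
  assumes "\<theta> 0 = 1" "\<And>k. 0 < \<alpha> k" and \<theta>: "\<And>k. (1 + \<alpha> k) * \<theta> (Suc k) = \<theta> k"
  shows "\<theta> k = (\<Prod>i<k. 1 / (1 + \<alpha> i))"
proof (induction k)
  case (Suc k)
  have "1 + \<alpha> k \<noteq> 0" using assms(2)[of k] by linarith
  then have "\<theta> (Suc k) = \<theta> k / (1 + \<alpha> k)" using \<theta>[of k] by (simp add: field_simps)
  then show ?case by (simp add: Suc.IH)
qed (simp add: \<open>\<theta> 0 = 1\<close>)

lemma discrete_Gronwall:
  fixes \<theta> \<alpha> e :: "nat \<Rightarrow> real"
  assumes "\<theta> 0 = 1" "\<And>k. 0 < \<alpha> k" and \<theta>: "\<And>k. (1 + \<alpha> k) * \<theta> (Suc k) = \<theta> k"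
    and e: "\<And>k. (1 + \<alpha> k) * e (Suc k) \<le> e k"
  shows "e k \<le> \<theta> k * e 0"
proof (induction k)
  case (Suc k)
  have "(1 + \<alpha> k) * e (Suc k) \<le> (1 + \<alpha> k) * (\<theta> (Suc k) * e 0)"
    using e[of k] Suc.IH by (simp add: \<theta> mult.assoc[symmetric])
  then show ?case using assms(2)[of k] by (simp add: mult_le_cancel_left_pos)
qed (simp add: \<open>\<theta> 0 = 1\<close>)

section \<open>Convergence rates of the fully implicit scheme\<close>

lemma aug_lagrangian_eq:
  fixes A :: "real ^ 'n ^ 'm"
  assumes "y \<in> X"
  shows "aug_lagrangian f X A b \<beta> y l
    = f y + ereal (\<beta> / 2 * (norm (A *v y - b))\<^sup>2 + l \<bullet> (A *v y - b))"
  using assms by (cases "f y") (auto simp: aug_lagrangian_def f_beta_def indicator_fun_def)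

theorem theorem3p1:
  fixes X :: "(real ^ 'n) set" and A :: "real ^ 'n ^ 'm" and b :: "real ^ 'm"
    and f :: "real ^ 'n \<Rightarrow> ereal" and \<mu> \<beta> :: real
    and xs :: "real ^ 'n" and ls :: "real ^ 'm"
    and \<theta> \<gamma> \<alpha> :: "nat \<Rightarrow> real"
    and x v :: "nat \<Rightarrow> real ^ 'n" and l :: "nat \<Rightarrow> real ^ 'm"
    and E :: "nat \<Rightarrow> ereal" and R0 :: ereal
  assumes "closed X" and "convex X"
    and "\<beta> \<ge> 0" and "\<mu> \<ge> 0" and "f \<in> S0_class \<mu> X"
    and "effective_domain f \<inter> X \<noteq> {}" and "b \<in> (\<lambda>y. A *v y) ` X"
    and "kkt_point f X A b xs ls"
    and "\<theta> 0 = 1" and "\<gamma> 0 > 0" and "x 0 \<in> X"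
    and "\<And>k. \<alpha> k > 0"
    and "\<And>k. (\<theta> (Suc k) - \<theta> k) / \<alpha> k = - \<theta> (Suc k)"
    and "\<And>k. (\<gamma> (Suc k) - \<gamma> k) / \<alpha> k = mu_beta \<mu> \<beta> A - \<gamma> (Suc k)"
    and "\<And>k. \<theta> k *\<^sub>R ((l (Suc k) - l k) /\<^sub>R \<alpha> k) = A *v v (Suc k) - b"
    and "\<And>k. (x (Suc k) - x k) /\<^sub>R \<alpha> k = v (Suc k) - x (Suc k)"
    and "\<And>k. \<gamma> k *\<^sub>R ((v (Suc k) - v k) /\<^sub>R \<alpha> k) \<in>
           (\<lambda>w. mu_beta \<mu> \<beta> A *\<^sub>R (x (Suc k) - v (Suc k)) - w) `
             kkt_operator (f_beta f A b \<beta>) X A (x (Suc k)) (l (Suc k))"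
  defines "E \<equiv> \<lambda>k. aug_lagrangian f X A b \<beta> (x k) ls - aug_lagrangian f X A b \<beta> xs (l k)
              + ereal (\<gamma> k / 2 * (norm (v k - xs))\<^sup>2) + ereal (\<theta> k / 2 * (norm (l k - ls))\<^sup>2)"
    and "R0 \<equiv> ereal_sqrt (2 * E 0) + ereal (norm (l 0 - ls)) + ereal (norm (A *v x 0 - b))"
  shows "(\<forall>k. x k \<in> X)
    \<and> (\<forall>k. ereal (1 + \<alpha> k) * E (Suc k) \<le> E k)
    \<and> (\<forall>k. \<theta> k = (\<Prod>i<k. 1 / (1 + \<alpha> i)))
    \<and> (\<forall>k. ereal (norm (A *v x k - b)) \<le> ereal (\<theta> k) * R0)
    \<and> (\<forall>k. 0 \<le> lagrangian f X A b (x k) ls - lagrangian f X A b xs (l k)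
           \<and> lagrangian f X A b (x k) ls - lagrangian f X A b xs (l k) \<le> ereal (\<theta> k) * E 0)
    \<and> (\<forall>k. \<bar>f (x k) - f xs\<bar> \<le> ereal (\<theta> k) * (E 0 + R0 * ereal (norm ls)))"
proof -
  define m where "m = mu_beta \<mu> \<beta> A"
  define D where "D = (\<lambda>k. A *v x k - b)"
  have \<alpha>: "0 < \<alpha> k" for k using assms(12) .
  have \<theta>_rec: "(1 + \<alpha> k) * \<theta> (Suc k) = \<theta> k" for k
    using assms(13)[of k] \<alpha>[of k] by (simp add: field_simps)
  have \<gamma>_rec: "(1 + \<alpha> k) * \<gamma> (Suc k) = \<gamma> k + \<alpha> k * m" for k
    using assms(14)[of k] \<alpha>[of k] unfolding m_def by (simp add: field_simps)
  have l_rec: "\<theta> k *\<^sub>R (l (Suc k) - l k) = \<alpha> k *\<^sub>R (A *v v (Suc k) - b)" for k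
    using \<alpha>[of k] by (simp add: assms(15)[symmetric])
  have x_rec: "x (Suc k) - x k = \<alpha> k *\<^sub>R (v (Suc k) - x (Suc k))" for k
    using \<alpha>[of k] by (simp add: assms(16)[symmetric])

  have \<theta>_prod: "\<theta> k = (\<Prod>i<k. 1 / (1 + \<alpha> i))" for k
    using decay_factor_eq_prod[OF assms(9) \<alpha> \<theta>_rec] .
  have \<theta>_pos: "0 < \<theta> k" for k
    unfolding \<theta>_prod using \<alpha> by (intro prod_pos) (simp add: add_pos_pos)
  have m: "0 \<le> m"
    using \<open>\<mu> \<ge> 0\<close> \<open>\<beta> \<ge> 0\<close> sigma_min_sq_Rayleigh(1)[of A] by (simp add: m_def mu_beta_def)
  have \<gamma>_nonneg: "0 \<le> \<gamma> k" for k
  proof (induction k)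
    case (Suc k)
    have "0 \<le> (1 + \<alpha> k) * \<gamma> (Suc k)" unfolding \<gamma>_rec using Suc m \<alpha>[of k] by simp
    then show ?case using \<alpha>[of k] by (simp add: zero_le_mult_iff)
  qed (use \<open>\<gamma> 0 > 0\<close> in simp)

  have "\<exists>p q. p \<in> subdifferential (f_beta f A b \<beta>) (x (Suc k)) \<and> q \<in> normal_cone X (x (Suc k))
      \<and> \<gamma> k *\<^sub>R ((v (Suc k) - v k) /\<^sub>R \<alpha> k)
          = m *\<^sub>R (x (Suc k) - v (Suc k)) - (p + q + transpose A *v l (Suc k))" for k
    using assms(17)[of k] unfolding kkt_operator_def m_def by blast
  then obtain p q where p: "\<And>k. p k \<in> subdifferential (f_beta f A b \<beta>) (x (Suc k))"
    and q: "\<And>k. q k \<in> normal_cone X (x (Suc k))"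
    and incl: "\<And>k. \<gamma> k *\<^sub>R ((v (Suc k) - v k) /\<^sub>R \<alpha> k)
          = m *\<^sub>R (x (Suc k) - v (Suc k)) - (p k + q k + transpose A *v l (Suc k))"
    by metis
  have v_rec: "\<gamma> k *\<^sub>R (v (Suc k) - v k)
      = \<alpha> k *\<^sub>R (m *\<^sub>R (x (Suc k) - v (Suc k)) - (p k + q k + transpose A *v l (Suc k)))" for k
    using \<alpha>[of k] by (simp only: incl[symmetric]) simp
  have xX: "x k \<in> X" for k
  proof (cases k)
    case (Suc j)
    then show ?thesis using q[of j] by (auto simp: normal_cone_def split: if_splits)
  qed (use \<open>x 0 \<in> X\<close> in simp)

  have proper: "proper_function f" using \<open>f \<in> S0_class \<mu> X\<close> by (simp add: S0_class_def)
  have xs: "xs \<in> X" "A *v xs = b" using \<open>kkt_point f X A b xs ls\<close> by (auto simp: kkt_point_def)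
  obtain fs where fs: "f xs = ereal fs"
    using \<open>kkt_point f X A b xs ls\<close> subdifferential_imp_finite[OF proper]
    by (cases "f xs") (force simp: kkt_point_def kkt_operator_def)+
  have f_cases: "f y = \<infinity> \<or> (\<exists>r. f y = ereal r)" for y
    using proper by (cases "f y") (auto simp: proper_function_def)
  have f_Suc_finite: "\<exists>r. f (x (Suc k)) = ereal r" for k
  proof -
    have "proper_function (f_beta f A b \<beta>)"
      using proper by (auto simp: proper_function_def f_beta_def)
    from subdifferential_imp_finite[OF this p[of k]] show ?thesis
      using f_cases[of "x (Suc k)"] by (auto simp: f_beta_def)
  qed

  \<comment> \<open>The value \<open>r\<close> of \<open>f\<close> at the iterate is a separate argument because it may be infinite at the starting point.\<close>
  define e where "e = (\<lambda>k r. r + \<beta> / 2 * (norm (D k))\<^sup>2 + ls \<bullet> D k - fs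
      + \<gamma> k / 2 * (norm (v k - xs))\<^sup>2 + \<theta> k / 2 * (norm (l k - ls))\<^sup>2)"
  have E_real: "E k = ereal (e k r)" if "f (x k) = ereal r" for k r
    using that by (simp add: E_def aug_lagrangian_eq xX xs fs e_def D_def)
  have E_top: "E k = \<infinity>" if "f (x k) = \<infinity>" for k
    using that by (simp add: E_def aug_lagrangian_eq xX xs fs)
  have gap_eq: "lagrangian f X A b (x k) ls - lagrangian f X A b xs (l k)
      = f (x k) + ereal (ls \<bullet> D k - fs)" for k
    using f_cases[of "x k"] by (auto simp: aug_lagrangian_eq xX xs fs D_def)
  have gap_nonneg: "0 \<le> f (x k) + ereal (ls \<bullet> D k - fs)" for k
    using kkt_point_lower_bound[OF \<open>kkt_point f X A b xs ls\<close> xX, of k] f_cases[of "x k"]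
    by (auto simp: fs D_def)

  have decay: "(1 + \<alpha> k) * e (Suc k) r' \<le> e k r"
    if r: "f (x k) = ereal r" and r': "f (x (Suc k)) = ereal r'" for k r r'
  proof -
    have strong: "r' + \<beta> / 2 * (norm (D (Suc k)))\<^sup>2 + p k \<bullet> (y - x (Suc k))
        + m / 2 * (norm (y - x (Suc k)))\<^sup>2 \<le> ry + \<beta> / 2 * (norm (A *v y - b))\<^sup>2"
      if "y \<in> X" "f y = ereal ry" for y ry
      using f_beta_strongly_convex[OF \<open>f \<in> S0_class \<mu> X\<close> \<open>\<beta> \<ge> 0\<close> xX \<open>y \<in> X\<close> p[of k]]
      by (simp add: f_beta_def r' that m_def D_def)
    have normal: "q k \<bullet> (y - x (Suc k)) \<le> 0" if "y \<in> X" for y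
      using q[of k] xX that by (auto simp: normal_cone_def)
    have "(1 + \<alpha> k) * ((r' + \<beta> / 2 * (norm (D (Suc k)))\<^sup>2) + ls \<bullet> (A *v x (Suc k) - b) - fs
        + \<gamma> (Suc k) / 2 * (norm (v (Suc k) - xs))\<^sup>2 + \<theta> (Suc k) / 2 * (norm (l (Suc k) - ls))\<^sup>2)
      \<le> (r + \<beta> / 2 * (norm (D k))\<^sup>2) + ls \<bullet> (A *v x k - b) - fs
        + \<gamma> k / 2 * (norm (v k - xs))\<^sup>2 + \<theta> k / 2 * (norm (l k - ls))\<^sup>2"
    proof (rule implicit_step_energy_decay[OF \<alpha> \<gamma>_nonneg less_imp_le[OF \<theta>_pos] \<theta>_rec \<gamma>_rec
          l_rec x_rec v_rec _ _ m xs(2)])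
      have "0 \<le> m / 2 * (norm (x k - x (Suc k)))\<^sup>2" using m by simp
      then show "r' + \<beta> / 2 * (norm (D (Suc k)))\<^sup>2 + (p k + q k) \<bullet> (x k - x (Suc k))
          \<le> r + \<beta> / 2 * (norm (D k))\<^sup>2"
        using strong[OF xX r] normal[OF xX, of k] unfolding inner_add_left D_def by linarith
      show "r' + \<beta> / 2 * (norm (D (Suc k)))\<^sup>2 + (p k + q k) \<bullet> (xs - x (Suc k))
          + m / 2 * (norm (xs - x (Suc k)))\<^sup>2 \<le> fs"
        using strong[OF xs(1) fs] normal[OF xs(1)] unfolding inner_add_left by (simp add: xs(2))
    qed
    then show ?thesis by (simp add: e_def D_def add.assoc)
  qed
  have E_decay: "ereal (1 + \<alpha> k) * E (Suc k) \<le> E k" for k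
    using f_cases[of "x k"] f_Suc_finite[of k] decay[of k] by (auto simp: E_top E_real)

  have residual: "D k = \<theta> k *\<^sub>R (l k - l 0 + D 0)" for k
  proof (rule multiplier_residual_invariant[OF assms(9) \<theta>_pos \<theta>_rec])
    fix k
    show "\<theta> k *\<^sub>R (l (Suc k) - l k) = (1 + \<alpha> k) *\<^sub>R D (Suc k) - D k"
      unfolding l_rec D_def by (rule extrapolated_residual[OF x_rec])
  qed

  \<comment> \<open>The extended arithmetic is confined to the case of an infinite initial energy;
      otherwise everything reduces to real numbers.\<close>
  have rates: "ereal (norm (D k)) \<le> ereal (\<theta> k) * R0
      \<and> f (x k) + ereal (ls \<bullet> D k - fs) \<le> ereal (\<theta> k) * E 0
      \<and> \<bar>f (x k) - f xs\<bar> \<le> ereal (\<theta> k) * (E 0 + R0 * ereal (norm ls))" for k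
  proof (cases "f (x 0) = \<infinity>")
    case True
    then have "E 0 = \<infinity>" by (rule E_top)
    moreover from this have "R0 = \<infinity>" by (simp add: R0_def ereal_sqrt_def)
    ultimately show ?thesis using \<theta>_pos[of k] by (cases "ls = 0") auto
  next
    case False
    then have "\<exists>r. f (x k) = ereal r" for k
      using f_cases[of "x 0"] f_Suc_finite by (cases k) auto
    then obtain r where r: "\<And>k. f (x k) = ereal (r k)" by metis
    define \<epsilon> where "\<epsilon> = (\<lambda>k. e k (r k))"
    have \<epsilon>_bound: "\<epsilon> k \<le> \<theta> k * \<epsilon> 0" for k
      using discrete_Gronwall[OF assms(9) \<alpha> \<theta>_rec, of \<epsilon>] decay[OF r r] by (simp add: \<epsilon>_def)
    have gap0: "0 \<le> r k + ls \<bullet> D k - fs" for k using gap_nonneg[of k] by (simp add: r)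
    have split: "\<epsilon> k = (r k + ls \<bullet> D k - fs) + \<beta> / 2 * (norm (D k))\<^sup>2
        + \<gamma> k / 2 * (norm (v k - xs))\<^sup>2 + \<theta> k / 2 * (norm (l k - ls))\<^sup>2" for k
      by (simp add: \<epsilon>_def e_def)
    have nonneg: "0 \<le> \<beta> / 2 * (norm (D k))\<^sup>2" "0 \<le> \<gamma> k / 2 * (norm (v k - xs))\<^sup>2"
      "0 \<le> \<theta> k / 2 * (norm (l k - ls))\<^sup>2" for k
      using \<open>\<beta> \<ge> 0\<close> \<gamma>_nonneg \<theta>_pos[of k] by auto
    have gap_le: "r k + ls \<bullet> D k - fs \<le> \<theta> k * \<epsilon> 0"
      using \<epsilon>_bound[of k] split[of k] nonneg[of k] by linarith
    have "\<theta> k / 2 * (norm (l k - ls))\<^sup>2 \<le> \<theta> k * \<epsilon> 0"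
      using \<epsilon>_bound[of k] split[of k] nonneg[of k] gap0[of k] by linarith
    then have "(norm (l k - ls))\<^sup>2 \<le> 2 * \<epsilon> 0" using \<theta>_pos[of k] by (simp add: field_simps)
    then have l_le: "norm (l k - ls) \<le> sqrt (2 * \<epsilon> 0)" by (rule real_le_rsqrt)
    define R where "R = sqrt (2 * \<epsilon> 0) + norm (l 0 - ls) + norm (D 0)"
    have E0: "E 0 = ereal (\<epsilon> 0)" using E_real[OF r] by (simp add: \<epsilon>_def)
    have R0: "R0 = ereal R" by (simp add: R0_def E0 R_def ereal_sqrt_def D_def)
    have "norm (l k - l 0 + D 0) \<le> R"
      using norm_triangle_ineq[of "l k - l 0" "D 0"] norm_triangle_ineq4[of "l k - ls" "l 0 - ls"] l_le
      by (simp add: R_def)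
    then have D_le: "norm (D k) \<le> \<theta> k * R"
      using \<theta>_pos[of k] by (subst residual) simp
    have "\<bar>ls \<bullet> D k\<bar> \<le> norm ls * (\<theta> k * R)"
      using Cauchy_Schwarz_ineq2[of ls "D k"] mult_left_mono[OF D_le, of "norm ls"] by simp
    then have "\<bar>r k - fs\<bar> \<le> \<theta> k * (\<epsilon> 0 + R * norm ls)"
      using gap0[of k] gap_le by (simp add: algebra_simps abs_le_iff)
    then show ?thesis using D_le gap_le by (simp add: r fs E0 R0)
  qed

  show ?thesis
  proof (intro conjI allI)
    fix k
    show "x k \<in> X" by (rule xX)
    show "ereal (1 + \<alpha> k) * E (Suc k) \<le> E k" by (rule E_decay)
    show "\<theta> k = (\<Prod>i<k. 1 / (1 + \<alpha> i))" by (rule \<theta>_prod)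
    show "ereal (norm (A *v x k - b)) \<le> ereal (\<theta> k) * R0"
      using rates[of k] unfolding D_def by (elim conjE)
    show "0 \<le> lagrangian f X A b (x k) ls - lagrangian f X A b xs (l k)"
      unfolding gap_eq by (rule gap_nonneg)
    show "lagrangian f X A b (x k) ls - lagrangian f X A b xs (l k) \<le> ereal (\<theta> k) * E 0"
      using rates[of k] unfolding gap_eq by (elim conjE)
    show "\<bar>f (x k) - f xs\<bar> \<le> ereal (\<theta> k) * (E 0 + R0 * ereal (norm ls))"
      using rates[of k] by (elim conjE)
  qed
qed

end
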